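(* Let $q$ be a prime power, let $n,t,s$ be positive integers with $\gcd(s,n)=1$, and let $\sigma\colon x\mapsto x^{q^s}$, an automorphism of $\mathbb{F}_{q^{nt}}$ (whose restriction generates $\mathrm{Gal}(\mathbb{F}_{q^n}\colon\mathbb{F}_q)$). Let $b_0,\dots,b_{t-1}\in\mathbb{F}_{q^{nt}}$ and \[ f(x)=-x+b_0x^{\sigma}+b_1x^{\sigma q^n}+b_2x^{\sigma q^{2n}}+\cdots+b_{t-1}x^{\sigma q^{n(t-1)}}. \] Let $G(x)=\sum_{i=0}^{t-1}b_ix^{q^{ni}}$, $H=G\circ\sigma$ and $L=H^{n-1}+H^{n-2}+\cdots+H+\mathrm{id}$. Then \[ \ker f=L(E_1(H^n)), \] where $E_1(H^n)=\{y\in\mathbb{F}_{q^{nt}}\colon H^n(y)=y\}$.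
   Context: Notation: $x^{\sigma q^{ni}}:=x^{q^{s+ni}}$. Polynomials are identified with the maps $\mathbb{F}_{q^{nt}}\to\mathbb{F}_{q^{nt}}$ they induce; $\ker f$ is the set of roots of $f$ in $\mathbb{F}_{q^{nt}}$. $H^i$ denotes the $i$-fold composition of $H$ with itself, and $\mathrm{id}$ the identity map. *)

theory Defs
  imports "HOL-Computational_Algebra.Polynomial" "HOL-Number_Theory.Prime_Powers"
begin

text \<open>
  The field with \<open>q ^ (n * t)\<close> elements is a type \<open>'a\<close> of sort \<open>{field, finite}\<close> whose
  cardinality is \<open>q ^ (n * t)\<close>. A coefficient tuple \<open>b\<^sub>0, \<dots>, b\<^sub>t\<^sub>-\<^sub>1\<close> is a function on
  \<open>nat\<close> of which only the values at \<open>i < t\<close> are used.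
\<close>

definition sigma_map :: "nat \<Rightarrow> nat \<Rightarrow> 'a::field \<Rightarrow> 'a" where
  "sigma_map q s x = x ^ (q ^ s)"

text \<open>The monomial \<open>x\<^bsup>\<sigma> q^(n i)\<^esup>\<close> stands for \<open>x\<close> to the power \<open>q ^ (s + n * i)\<close>.\<close>

definition f_poly :: "nat \<Rightarrow> nat \<Rightarrow> nat \<Rightarrow> nat \<Rightarrow> (nat \<Rightarrow> 'a::field) \<Rightarrow> 'a poly" where
  "f_poly q n t s b = - monom 1 1 + (\<Sum>i<t. monom (b i) (q ^ (s + n * i)))"

definition G_poly :: "nat \<Rightarrow> nat \<Rightarrow> nat \<Rightarrow> (nat \<Rightarrow> 'a::field) \<Rightarrow> 'a poly" where
  "G_poly q n t b = (\<Sum>i<t. monom (b i) (q ^ (n * i)))"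

definition H_map :: "nat \<Rightarrow> nat \<Rightarrow> nat \<Rightarrow> nat \<Rightarrow> (nat \<Rightarrow> 'a::field) \<Rightarrow> 'a \<Rightarrow> 'a" where
  "H_map q n t s b = poly (G_poly q n t b) \<circ> sigma_map q s"

definition L_map :: "nat \<Rightarrow> nat \<Rightarrow> nat \<Rightarrow> nat \<Rightarrow> (nat \<Rightarrow> 'a::field) \<Rightarrow> 'a \<Rightarrow> 'a" where
  "L_map q n t s b y = (\<Sum>i<n. (H_map q n t s b ^^ i) y)"

definition ker_poly :: "'a::field poly \<Rightarrow> 'a set" where
  "ker_poly p = {x. poly p x = 0}"

definition E1 :: "('a \<Rightarrow> 'a) \<Rightarrow> 'a set" where
  "E1 \<phi> = {y. \<phi> y = y}"

end

theory Submission
  imports Defs "HOL-Number_Theory.Residues"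
begin

text \<open>
  As maps, \<open>f = H - id\<close>, so \<open>ker f = E\<^sub>1(H)\<close>. Since \<open>H\<close> is additive, \<open>H (L y) - L y = H\<^sup>n y - y\<close>,
  which gives one inclusion. Conversely, \<open>H\<close> is \<open>\<sigma>\<close>-semilinear over the subfield with \<open>q\<^sup>n\<close>
  elements: if \<open>H x = x\<close> and \<open>c\<close> is in that subfield, then \<open>H\<^sup>n (c x) = c x\<close> and \<open>L (c x) = Tr(c) x\<close>,
  where \<open>Tr\<close> is the trace to the subfield with \<open>q\<close> elements. So \<open>x = L (c x)\<close> for any \<open>c\<close> of
  trace 1.
\<close>

text \<open>Multiplication by \<open>x \<noteq> 0\<close> permutes the nonzero elements, so
  comparing their product before and after shows that \<open>x\<close> to the number of nonzero
  elements is 1.\<close>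

lemma power_card_UNIV_eq_same:
  fixes x :: "'a::{field, finite}"
  shows "x ^ card (UNIV :: 'a set) = x"
proof (cases "x = 0")
  case True
  then show ?thesis
    by (simp add: finite_UNIV_card_ge_0)
next
  case False
  let ?U = "UNIV - {0 :: 'a}"
  have "bij_betw ((*) x) ?U ?U"
    by (rule bij_betw_byWitness[where f' = "\<lambda>y. y / x"]) (use False in auto)
  then have "(\<Prod>y\<in>?U. x * y) = \<Prod>?U"
    by (rule prod.reindex_bij_betw)
  moreover have "\<Prod>?U \<noteq> 0"
    by simp
  ultimately have "x ^ card ?U = 1"
    by (simp add: prod.distrib)
  moreover have "card (UNIV :: 'a set) = Suc (card ?U)"
    by (rule card.remove) auto
  ultimately show ?thesis
    by (simp only: power_Suc mult_1_right)
qed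

text \<open>The characteristic is a prime dividing the cardinality, a power of the prime below
  \<open>q\<close>. This makes \<open>q\<close>-powers additive.\<close>

lemma primepow_card_UNIV_CHAR:
  fixes q m :: nat
  assumes "primepow q" and "card (UNIV :: 'a::{field, finite} set) = q ^ m"
  shows "prime CHAR('a)" and "\<exists>k. q = CHAR('a) ^ k"
proof -
  show prime: "prime CHAR('a)"
    by (intro prime_CHAR_semidom finite_imp_CHAR_pos) simp
  obtain p k where p: "prime p" "q = p ^ k"
    using assms(1) by (auto simp: primepow_def)
  have "CHAR('a) dvd p ^ (k * m)"
    using CHAR_dvd_CARD[where 'a = 'a] by (simp add: assms(2) p power_mult)
  then have "CHAR('a) = p"
    using prime p(1) prime_dvd_power primes_dvd_imp_eq by blast
  with p show "\<exists>k. q = CHAR('a) ^ k"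
    by blast
qed

lemma sum_power_primepow:
  fixes q m j :: nat and g :: "'b \<Rightarrow> 'a::{field, finite}"
  assumes "primepow q" and "card (UNIV :: 'a set) = q ^ m"
  shows "sum g A ^ (q ^ j) = (\<Sum>i\<in>A. g i ^ (q ^ j))"
proof -
  obtain k where "q = CHAR('a) ^ k"
    using primepow_card_UNIV_CHAR(2)[OF assms] by blast
  then have "q ^ j = CHAR('a) ^ (k * j)"
    by (simp add: power_mult)
  then show ?thesis
    by (rule freshmans_dream_sum'[OF primepow_card_UNIV_CHAR(1)[OF assms]])
qed

lemma power_power_fixed:
  fixes c :: "'a::monoid_mult"
  assumes "c ^ (q ^ n) = c"
  shows "c ^ (q ^ (n * i)) = c"
  by (induction i) (simp_all add: power_add power_mult assms)

lemma power_power_mod: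
  fixes c :: "'a::monoid_mult"
  assumes "c ^ (q ^ n) = c"
  shows "c ^ (q ^ (k mod n)) = c ^ (q ^ k)"
proof -
  have "c ^ (q ^ k) = c ^ (q ^ (n * (k div n) + k mod n))"
    by simp
  also have "\<dots> = (c ^ (q ^ (n * (k div n)))) ^ (q ^ (k mod n))"
    by (simp only: power_add power_mult)
  also have "\<dots> = c ^ (q ^ (k mod n))"
    by (simp only: power_power_fixed[OF assms])
  finally show ?thesis ..
qed

lemma bij_betw_mult_mod:
  fixes s n :: nat
  assumes "coprime s n"
  shows "bij_betw (\<lambda>i. s * i mod n) {..<n} {..<n}"
proof -
  have inj: "inj_on (\<lambda>i. s * i mod n) {..<n}"
  proof (rule inj_onI)
    fix i j assume ij: "i \<in> {..<n}" "j \<in> {..<n}" and "s * i mod n = s * j mod n"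
    then have "[i = j] (mod n)"
      using assms by (simp add: cong_mult_lcancel_nat flip: cong_def)
    then show "i = j"
      using ij by (simp add: cong_def)
  qed
  have "(\<lambda>i. s * i mod n) ` {..<n} = {..<n}"
    by (rule endo_inj_surj[OF _ _ inj]) auto
  with inj show ?thesis
    by (simp add: bij_betw_def)
qed

text \<open>Exponents of Frobenius matter only modulo \<open>n\<close> on such a \<open>c\<close>,
  and multiplication by \<open>s\<close> permutes the residues. So the trace can be summed along
  powers of \<sigma>.\<close>

lemma sum_power_power_coprime:
  fixes c :: "'a::semiring_1"
  assumes "c ^ (q ^ n) = c" and "coprime s n"
  shows "(\<Sum>i<n. c ^ (q ^ (s * i))) = (\<Sum>j<n. c ^ (q ^ j))"
proof -
  have "(\<Sum>i<n. c ^ (q ^ (s * i))) = (\<Sum>i<n. c ^ (q ^ (s * i mod n)))"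
    by (simp only: power_power_mod[OF assms(1)])
  also have "\<dots> = (\<Sum>j<n. c ^ (q ^ j))"
    by (rule sum.reindex_bij_betw[OF bij_betw_mult_mod[OF assms(2)]])
  finally show ?thesis .
qed

text \<open>An identically vanishing trace would be a polynomial of degree at most
  \<open>q ^ (m - 1)\<close> with \<open>q ^ m\<close> roots, hence zero, but its linear coefficient
  is 1.\<close>

lemma exists_absolute_trace_nonzero:
  fixes q m :: nat
  assumes "1 < q" and "0 < m" and "card (UNIV :: 'a::{field, finite} set) = q ^ m"
  shows "\<exists>x :: 'a. (\<Sum>j<m. x ^ (q ^ j)) \<noteq> 0"
proof (rule ccontr)
  assume *: "\<nexists>x :: 'a. (\<Sum>j<m. x ^ (q ^ j)) \<noteq> 0"
  define T :: "'a poly" where "T = (\<Sum>j<m. Polynomial.monom 1 (q ^ j))"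
  have "Polynomial.degree T \<le> q ^ (m - 1)"
    unfolding T_def using assms(1)
    by (intro degree_sum_le) (auto intro!: order.trans[OF degree_monom_le] power_increasing)
  also have "\<dots> < card (UNIV :: 'a set)"
    using assms by (simp add: power_strict_increasing)
  finally have "Polynomial.degree T < card (UNIV :: 'a set)" .
  then have "T = 0"
    using * by (intro poly_eqI_degree[where A = UNIV])
      (auto simp: T_def poly_sum poly_monom finite_UNIV_card_ge_0)
  moreover have "Polynomial.coeff T 1 = (\<Sum>j<m. if j = 0 then 1 else 0)"
    unfolding T_def coeff_sum using assms(1) by (intro sum.cong) auto
  ultimately show False
    using assms(2) by simp
qed

text \<open>Transitivity of the trace: \<open>y\<close> is the trace of \<open>x\<close> to the
  subfield with \<open>q ^ n\<close> elements, and the trace \<open>z\<close> of \<open>y\<close> is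
  the absolute trace of \<open>x\<close>. As \<open>z\<close> is nonzero and Frobenius-fixed,
  \<open>y / z\<close> has trace 1.\<close>

lemma exists_subfield_trace_one:
  fixes q n t :: nat
  assumes "primepow q" and "0 < n" and "0 < t"
    and card: "card (UNIV :: 'a::{field, finite} set) = q ^ (n * t)"
  shows "\<exists>c :: 'a. c ^ (q ^ n) = c \<and> (\<Sum>j<n. c ^ (q ^ j)) = 1"
proof -
  note frob_sum = sum_power_primepow[OF assms(1) card]
  obtain x :: 'a where x: "(\<Sum>j<n * t. x ^ (q ^ j)) \<noteq> 0"
    using exists_absolute_trace_nonzero[OF _ _ card] assms primepow_gt_Suc_0[OF assms(1)] by auto
  define y where "y = (\<Sum>i<t. x ^ (q ^ (n * i)))"
  define z where "z = (\<Sum>j<n. y ^ (q ^ j))"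
  have "y ^ (q ^ n) = (\<Sum>i<t. x ^ (q ^ (n * Suc i)))"
    by (simp add: y_def frob_sum power_add mult.commute flip: power_mult)
  \<comment> \<open>The index shift trades the first term \<open>x\<close> for
    \<open>x ^ (q ^ (n * t))\<close>, which is again \<open>x\<close>.\<close>
  also have "\<dots> = y + (x ^ (q ^ (n * t)) - x)"
    using sum.lessThan_Suc_shift[of "\<lambda>i. x ^ (q ^ (n * i))" t]
    by (simp add: y_def algebra_simps)
  also have "\<dots> = y"
    using power_card_UNIV_eq_same[of x] by (simp add: card)
  finally have y: "y ^ (q ^ n) = y" .
  have "z = (\<Sum>j<n. \<Sum>i<t. x ^ (q ^ (n * i + j)))"
    by (simp add: z_def y_def frob_sum power_add flip: power_mult)
  also have "\<dots> = (\<Sum>i<t. \<Sum>j<n. x ^ (q ^ (j + i * n)))"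
    by (subst sum.swap) (simp add: ac_simps)
  \<comment> \<open>Division with remainder by \<open>n\<close> makes the exponents
    \<open>j + i * n\<close> run once through all numbers below \<open>n * t\<close>.\<close>
  also have "\<dots> = (\<Sum>j<n * t. x ^ (q ^ j))"
    using sum.nat_group[of "\<lambda>j. x ^ (q ^ j)" n t]
      sum.shift_bounds_nat_ivl[of "\<lambda>j. x ^ (q ^ j)" 0 "i * n" n for i]
    by (simp add: mult.commute add.commute lessThan_atLeast0)
  finally have "z \<noteq> 0"
    using x by simp
  have "z ^ q = (\<Sum>j<n. y ^ (q ^ Suc j))"
    by (simp add: z_def frob_sum[of _ _ 1, simplified] mult.commute flip: power_mult)
  also have "\<dots> = z + (y ^ (q ^ n) - y)"
    using sum.lessThan_Suc_shift[of "\<lambda>j. y ^ (q ^ j)" n]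
    by (simp add: z_def algebra_simps)
  finally have "z ^ (q ^ 1) = z"
    by (simp add: y)
  then have z: "z ^ (q ^ j) = z" for j
    using power_power_fixed[of z q 1 j] by simp
  have "(\<Sum>j<n. (y / z) ^ (q ^ j)) = (\<Sum>j<n. y ^ (q ^ j)) / z"
    by (simp add: power_divide z sum_divide_distrib)
  then have "(\<Sum>j<n. (y / z) ^ (q ^ j)) = z / z"
    by (simp only: z_def)
  then show ?thesis
    using y z \<open>z \<noteq> 0\<close> by (intro exI[of _ "y / z"]) (simp add: power_divide)
qed

lemma H_map_eq: "H_map q n t s b x = (\<Sum>i<t. b i * x ^ (q ^ (s + n * i)))"
  by (simp add: H_map_def G_poly_def sigma_map_def poly_sum poly_monom power_add flip: power_mult)

lemma ker_f_poly_eq: "ker_poly (f_poly q n t s b) = E1 (H_map q n t s b)"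
proof -
  have "poly (f_poly q n t s b) x = H_map q n t s b x - x" for x
    by (simp add: f_poly_def H_map_eq poly_sum poly_monom)
  then show ?thesis
    by (simp add: ker_poly_def E1_def)
qed

lemma H_map_sum:
  fixes b :: "nat \<Rightarrow> 'a::{field, finite}"
  assumes "primepow q" and "card (UNIV :: 'a set) = q ^ m"
  shows "H_map q n t s b (sum g A) = (\<Sum>i\<in>A. H_map q n t s b (g i))"
  unfolding H_map_eq sum_power_primepow[OF assms] sum_distrib_left by (rule sum.swap)

text \<open>Every exponent in \<open>H_map\<close> is \<open>q ^ (s + n * i)\<close>, and the part
  \<open>n * i\<close> acts trivially on \<open>c\<close>.\<close>

lemma H_map_mult:
  assumes "c ^ (q ^ n) = c"
  shows "H_map q n t s b (c * x) = c ^ (q ^ s) * H_map q n t s b x"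
proof -
  have "c ^ (q ^ (s + n * i)) = c ^ (q ^ s)" for i
    using power_power_fixed[OF assms, of i]
    by (metis add.commute power_add power_mult)
  then show ?thesis
    by (simp add: H_map_eq power_mult_distrib sum_distrib_left mult_ac)
qed

text \<open>Each application of \<open>H_map\<close> fixes \<open>x\<close> and applies \<sigma> to
  the scalar, which stays in the subfield, so semilinearity applies again.\<close>

lemma funpow_H_map_mult:
  assumes "c ^ (q ^ n) = c" and "H_map q n t s b x = x"
  shows "(H_map q n t s b ^^ i) (c * x) = c ^ (q ^ (s * i)) * x"
proof (induction i)
  case (Suc i)
  have "(c ^ (q ^ (s * i))) ^ (q ^ n) = c ^ (q ^ (s * i))"
    by (metis assms(1) mult.commute power_mult)
  from H_map_mult[OF this] show ?case
    by (simp add: Suc.IH assms(2) power_add mult.commute flip: power_mult)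
qed simp

theorem theorem3p1:
  fixes q n t s :: nat
    and b :: "nat \<Rightarrow> 'a::{field, finite}"
  assumes "primepow q"
    and "0 < n" and "0 < t" and "0 < s"
    and "gcd s n = 1"
    and "card (UNIV :: 'a set) = q ^ (n * t)"
  shows "ker_poly (f_poly q n t s b) = L_map q n t s b ` E1 (H_map q n t s b ^^ n)"
proof -
  let ?H = "H_map q n t s b" and ?L = "L_map q n t s b"
  obtain c :: 'a where c: "c ^ (q ^ n) = c" "(\<Sum>j<n. c ^ (q ^ j)) = 1"
    using exists_subfield_trace_one[OF assms(1,2,3,6)] by blast
  have "E1 ?H = ?L ` E1 (?H ^^ n)"
  proof (intro equalityI subsetI)
    fix x assume "x \<in> E1 ?H"
    then have iter: "(?H ^^ i) (c * x) = c ^ (q ^ (s * i)) * x" for i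
      using c(1) by (intro funpow_H_map_mult) (auto simp: E1_def)
    have "?L (c * x) = (\<Sum>i<n. c ^ (q ^ (s * i))) * x"
      by (simp add: L_map_def iter sum_distrib_right)
    also have "\<dots> = x"
      using sum_power_power_coprime[OF c(1)] assms(5) c(2) by (simp add: coprime_iff_gcd_eq_1)
    finally have "x = ?L (c * x)" ..
    \<comment> \<open>The scalar becomes \<open>c ^ (q ^ (s * n))\<close>, which is \<open>c\<close>
      because the exponent is a multiple of \<open>n\<close>.\<close>
    moreover have "c * x \<in> E1 (?H ^^ n)"
      using power_power_fixed[OF c(1), of s] by (simp add: E1_def iter mult.commute)
    ultimately show "x \<in> ?L ` E1 (?H ^^ n)"
      by (rule image_eqI)
  next
    fix x assume "x \<in> ?L ` E1 (?H ^^ n)"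
    then obtain y where x: "x = ?L y" and y: "(?H ^^ n) y = y"
      by (auto simp: E1_def)
    have "?H x = (\<Sum>i<n. (?H ^^ Suc i) y)"
      by (simp add: x L_map_def H_map_sum[OF assms(1,6)])
    \<comment> \<open>Telescoping: the shifted sum loses the term \<open>y\<close> for
      \<open>i = 0\<close> and gains the \<open>n\<close>-th iterate.\<close>
    also have "\<dots> = x + ((?H ^^ n) y - y)"
      using sum.lessThan_Suc_shift[of "\<lambda>i. (?H ^^ i) y" n]
      by (simp add: x L_map_def algebra_simps)
    finally show "x \<in> E1 ?H"
      by (simp add: E1_def y)
  qed
  then show ?thesis
    by (simp only: ker_f_poly_eq)
qed

end
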